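(* Let $(a,b,c)\in\mathcal{A}=\big\{(a,b,c)\in\frac12\mathbb{Z}\times\frac12\mathbb{Z}\times\mathbb{Z} : a+b\in\mathbb{Z}\big\}$. Then $(a,b,c)$ is equal to $\big(A(\mathcal{P}),\frac12B(\mathcal{P}),C(\mathcal{P})\big)$ for some unimodular lattice multi-polygon $\mathcal{P}$ if and only if $a=b$.
   Context: A lattice multi-polygon is a sequence $\mathcal{P}=(v_1,\dots,v_d)$ of points of $\mathbb{Z}^2$, with $v_i\ne v_{i+1}$ for all $i$ (indices cyclic modulo $d$, $v_{d+1}=v_1$), regarded as an oriented closed piecewise linear loop obtained by joining $v_i$ to $v_{i+1}$ by a straight segment (the side $v_iv_{i+1}$), together with a sign $\epsilon(v_iv_{i+1})\in\{+1,-1\}$ for each side, such that whenever three consecutive points $v_{i-1},v_i,v_{i+1}$ lie on a line: (1) $\epsilon(v_{i-1}v_i)=\epsilon(v_iv_{i+1})$ if $v_i$ is in between $v_{i-1}$ and $v_{i+1}$; (2) $\epsilon(v_{i-1}v_i)\ne\epsilon(v_iv_{i+1})$ if $v_{i-1}$ lies on the segment $v_iv_{i+1}$ or $v_{i+1}$ lies on the segment $v_{i-1}v_i$. The loop may have self-intersections. A sequence $v_1,\dots,v_d$ in $\mathbb{Z}^2$ ($d\ge2$) is unimodular if for every $i=1,\dots,d$ the triangle with vertices $(0,0),v_i,v_{i+1}$ contains no lattice point except its vertices; equivalently $\det(v_i,v_{i+1})=\pm1$. A lattice multi-polygon $\mathcal{P}=(v_1,\dots,v_d)$ is unimodular if the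 sequence $(v_1,\dots,v_d)$ is unimodular and its sign assignment is $\epsilon(v_iv_{i+1})=\det(v_i,v_{i+1})$ for $i=1,\dots,d$. For each $i$, $n_i$ denotes a normal vector to the side $v_iv_{i+1}$ such that the 90 degree (counterclockwise) rotation of $\epsilon(v_iv_{i+1})n_i$ has the same direction as the vector from $v_i$ to $v_{i+1}$. Because of (1) and (2), $n_i$ and $n_{i+1}$ never point in opposite directions. For $v\in\mathbb{R}^2$ not on any side of $\mathcal{P}$, $d_{\mathcal{P}}(v)$ is the winding number of the oriented loop $\mathcal{P}$ around $v$ (counterclockwise positive). Define: - $A(\mathcal{P})=\int_{\mathbb{R}^2\setminus\mathcal{P}}d_{\mathcal{P}}(v)\,dv$, where $\mathbb{R}^2\setminus\mathcal{P}$ is the set of points lying on no side of $\mathcal{P}$. - $B(\mathcal{P})=\sum_{i=1}^d\epsilon(v_iv_{i+1})\,|v_iv_{i+1}|$, where $|v_iv_{i+1}|$ is the number of lattice points on the segment $v_iv_{i+1}$ minus $1$. - $C(\mathcal{P})$ is the rotation number of the sequence $n_1,\dots,n_d$ around the origin, that is, $\frac1{2\pi}\sum_{i=1}^d\theta_i$, where $\theta_i\in(-\pi,\pi)$ is the signed angle (counterclockwise positive) from $n_i$ to $n_{i+1}$, with $n_{d+1}=n_1$. *)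

theory Defs
  imports "HOL-Complex_Analysis.Complex_Analysis"
begin

(* The plane is modelled by the type complex. *)
definition lat :: "int \<times> int \<Rightarrow> complex" where
  "lat p = Complex (of_int (fst p)) (of_int (snd p))"

definition det2 :: "int \<times> int \<Rightarrow> int \<times> int \<Rightarrow> int" where
  "det2 u v = fst u * snd v - snd u * fst v"

(* signs ! i is the sign of the side joining the i-th vertex to the next one. *)
record multi_polygon =
  verts :: "(int \<times> int) list"
  signs :: "int list"

(* Vertices and signs are numbered from 0, cyclically modulo the number of vertices. *)
definition vtx :: "multi_polygon \<Rightarrow> nat \<Rightarrow> int \<times> int" where
  "vtx P i = verts P ! (i mod length (verts P))"

definition sgn_side :: "multi_polygon \<Rightarrow> nat \<Rightarrow> int" where
  "sgn_side P i = signs P ! (i mod length (verts P))"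

definition side :: "multi_polygon \<Rightarrow> nat \<Rightarrow> complex set" where
  "side P i = closed_segment (lat (vtx P i)) (lat (vtx P (i + 1)))"

definition lattice_multi_polygon :: "multi_polygon \<Rightarrow> bool" where
  "lattice_multi_polygon P \<longleftrightarrow>
     verts P \<noteq> [] \<and> length (signs P) = length (verts P) \<and>
     (\<forall>i < length (verts P). vtx P i \<noteq> vtx P (i + 1)) \<and>
     (\<forall>i < length (verts P). sgn_side P i \<in> {1, -1}) \<and>
     (\<forall>i < length (verts P).
        collinear {lat (vtx P i), lat (vtx P (i + 1)), lat (vtx P (i + 2))} \<longrightarrow>
          (lat (vtx P (i + 1)) \<in> closed_segment (lat (vtx P i)) (lat (vtx P (i + 2)))
             \<longrightarrow> sgn_side P i = sgn_side P (i + 1)) \<and>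
          (lat (vtx P i) \<in> side P (i + 1) \<or> lat (vtx P (i + 2)) \<in> side P i
             \<longrightarrow> sgn_side P i \<noteq> sgn_side P (i + 1)))"

(* A triangle is understood to be nondegenerate; without this requirement the
   equivalence with a determinant of 1 or -1 (proved below) would fail, for instance
   for v = u with u primitive. *)
definition empty_triangle :: "int \<times> int \<Rightarrow> int \<times> int \<Rightarrow> bool" where
  "empty_triangle u v \<longleftrightarrow>
     \<not> collinear {0, lat u, lat v} \<and>
     {p. lat p \<in> convex hull {0, lat u, lat v}} = {(0, 0), u, v}"

definition unimodular_seq :: "(int \<times> int) list \<Rightarrow> bool" where
  "unimodular_seq vs \<longleftrightarrow>
     2 \<le> length vs \<and>
     (\<forall>i < length vs. empty_triangle (vs ! i) (vs ! ((i + 1) mod length vs)))"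

definition unimodular_multi_polygon :: "multi_polygon \<Rightarrow> bool" where
  "unimodular_multi_polygon P \<longleftrightarrow>
     lattice_multi_polygon P \<and> unimodular_seq (verts P) \<and>
     (\<forall>i < length (verts P). sgn_side P i = det2 (vtx P i) (vtx P (i + 1)))"

fun polygonal_path :: "complex list \<Rightarrow> real \<Rightarrow> complex" where
  "polygonal_path [] = linepath 0 0"
| "polygonal_path [x] = linepath x x"
| "polygonal_path [x, y] = linepath x y"
| "polygonal_path (x # y # z # zs) = linepath x y +++ polygonal_path (y # z # zs)"

definition loop :: "multi_polygon \<Rightarrow> real \<Rightarrow> complex" where
  "loop P = polygonal_path (map lat (verts P @ [hd (verts P)]))"

(* The library's winding number is complex-valued; off the loop it is an integer. *)
definition area_A :: "multi_polygon \<Rightarrow> real" where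
  "area_A P =
     set_lebesgue_integral lborel (- (\<Union>i < length (verts P). side P i))
       (\<lambda>z. Re (winding_number (loop P) z))"

definition lattice_length :: "int \<times> int \<Rightarrow> int \<times> int \<Rightarrow> int" where
  "lattice_length u v = int (card {p. lat p \<in> closed_segment (lat u) (lat v)}) - 1"

definition boundary_B :: "multi_polygon \<Rightarrow> int" where
  "boundary_B P =
     (\<Sum>i < length (verts P). sgn_side P i * lattice_length (vtx P i) (vtx P (i + 1)))"

(* The normal is only determined up to a positive factor; this one has the length of the
   side. Multiplication by \<i> is the counterclockwise rotation by 90 degrees, and it
   takes sgn_side P i * normal P i to the side vector, as sgn_side P i is 1 or -1. *)
definition normal :: "multi_polygon \<Rightarrow> nat \<Rightarrow> complex" where
  "normal P i = - \<i> * of_int (sgn_side P i) * (lat (vtx P (i + 1)) - lat (vtx P i))"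

(* Arg takes values in the interval from -pi (excluded) to pi; the value pi does not occur
   here, because consecutive normals never point in opposite directions. *)
definition rotation_C :: "multi_polygon \<Rightarrow> real" where
  "rotation_C P =
     1 / (2 * pi) * (\<Sum>i < length (verts P). Arg (normal P (i + 1) / normal P i))"

definition triples_A :: "(real \<times> real \<times> real) set" where
  "triples_A = {(a, b, c). 2 * a \<in> \<int> \<and> 2 * b \<in> \<int> \<and> c \<in> \<int> \<and> a + b \<in> \<int>}"


lemma lat_eq_iff: "lat p = lat q \<longleftrightarrow> p = q"
  by (auto simp: lat_def prod_eq_iff)

lemma in_triangle_iff:
  "lat p \<in> convex hull {0, lat u, lat v} \<longleftrightarrow>
     (\<exists>s t :: real. 0 \<le> s \<and> 0 \<le> t \<and> s + t \<le> 1 \<and>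
        of_int (fst p) = s * of_int (fst u) + t * of_int (fst v) \<and>
        of_int (snd p) = s * of_int (snd u) + t * of_int (snd v))"
proof -
  have "lat p \<in> convex hull {0, lat u, lat v} \<longleftrightarrow>
    (\<exists>r s t. 0 \<le> r \<and> 0 \<le> s \<and> 0 \<le> t \<and> r + s + t = 1 \<and> lat p = r *\<^sub>R 0 + s *\<^sub>R lat u + t *\<^sub>R lat v)"
    unfolding convex_hull_3 by (auto 4 4)
  also have "\<dots> \<longleftrightarrow> (\<exists>s t. 0 \<le> s \<and> 0 \<le> t \<and> s + t \<le> 1 \<and> lat p = s *\<^sub>R lat u + t *\<^sub>R lat v)"
    (is "?L = ?R")
  proof
    assume ?R
    then obtain s t where "0 \<le> s" "0 \<le> t" "s + t \<le> 1" "lat p = s *\<^sub>R lat u + t *\<^sub>R lat v" by blast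
    then show ?L
      by (intro exI[of _ "1 - s - t"] exI[of _ s] exI[of _ t]) auto
  next
    assume ?L
    then obtain r s t where "0 \<le> r" "0 \<le> s" "0 \<le> t" "r + s + t = 1"
      "lat p = r *\<^sub>R 0 + s *\<^sub>R lat u + t *\<^sub>R lat v" by blast
    then show ?R
      by (intro exI[of _ s] exI[of _ t]) auto
  qed
  finally show ?thesis
    by (simp add: lat_def complex_eq_iff)
qed

lemma collinear_lat_iff: "collinear {0, lat u, lat v} \<longleftrightarrow> det2 u v = 0"
proof -
  have "collinear {0, lat u, lat v} \<longleftrightarrow> lat u = 0 \<or> (\<exists>c. lat v = c *\<^sub>R lat u)"
    by (auto simp: collinear_lemma)
  also have "\<dots> \<longleftrightarrow> det2 u v = 0"
  proof
    assume "lat u = 0 \<or> (\<exists>c. lat v = c *\<^sub>R lat u)"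
    then have "real_of_int (det2 u v) = 0"
      by (auto simp: lat_def det2_def complex_eq_iff)
    then show "det2 u v = 0" by linarith
  next
    assume "det2 u v = 0"
    then have "real_of_int (fst u * snd v - snd u * fst v) = 0" by (simp add: det2_def)
    then have e: "real_of_int (fst u) * snd v = real_of_int (snd u) * fst v" by simp
    show "lat u = 0 \<or> (\<exists>c. lat v = c *\<^sub>R lat u)"
    proof (cases "fst u = 0")
      case False
      then have "lat v = (real_of_int (fst v) / fst u) *\<^sub>R lat u"
        using e by (simp add: lat_def complex_eq_iff field_simps)
      then show ?thesis by blast
    next
      case True
      show ?thesis
      proof (cases "snd u = 0")
        case False
        then have "lat v = (real_of_int (snd v) / snd u) *\<^sub>R lat u"
          using e True by (simp add: lat_def complex_eq_iff field_simps)
        then show ?thesis by blast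
      qed (use True in \<open>simp add: lat_def complex_eq_iff\<close>)
    qed
  qed
  finally show ?thesis .
qed

lemma empty_triangle_iff_det2: "empty_triangle u v \<longleftrightarrow> det2 u v \<in> {1, -1}"
proof -
  obtain u1 u2 v1 v2 where uv: "u = (u1, u2)" "v = (v1, v2)" by (metis surj_pair)
  define D where "D = u1 * v2 - u2 * v1"
  have D: "det2 u v = D" by (simp add: uv det2_def D_def)
  show ?thesis
  proof
    assume "det2 u v \<in> {1, -1}"
    then have D1: "D * D = 1" "D \<noteq> 0" by (auto simp: D)
    have "p \<in> {(0, 0), u, v}" if p: "lat p \<in> convex hull {0, lat u, lat v}" for p
    proof -
      obtain p1 p2 where pp: "p = (p1, p2)" by (metis surj_pair)
      obtain s t :: real where st: "0 \<le> s" "0 \<le> t" "s + t \<le> 1"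
        "real_of_int p1 = s * u1 + t * v1" "real_of_int p2 = s * u2 + t * v2"
        using p by (auto simp: in_triangle_iff pp uv)
      have "real_of_int (D * (p1 * v2 - p2 * v1)) = s * real_of_int (D * D)"
        unfolding D_def by (simp add: st algebra_simps)
      then have "s = real_of_int (D * (p1 * v2 - p2 * v1))" unfolding D1(1) by simp
      then have s: "s \<in> \<int>" by (metis Ints_of_int)
      have "real_of_int (D * (p2 * u1 - p1 * u2)) = t * real_of_int (D * D)"
        unfolding D_def by (simp add: st algebra_simps)
      then have "t = real_of_int (D * (p2 * u1 - p1 * u2))" unfolding D1(1) by simp
      then have t: "t \<in> \<int>" by (metis Ints_of_int)
      obtain m n where mn: "s = of_int m" "t = of_int n" using s t by (auto elim!: Ints_cases)
      then have "0 \<le> m" "0 \<le> n" "m + n \<le> 1"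
        using st(1-3) by (simp, simp, linarith)
      then have "(m = 0 \<and> n = 0) \<or> (m = 1 \<and> n = 0) \<or> (m = 0 \<and> n = 1)" by linarith
      then show ?thesis using st(4,5) by (auto simp: mn pp uv)
    qed
    moreover have "lat p \<in> convex hull {0, lat u, lat v}" if "p \<in> {(0, 0), u, v}" for p
      using that by (auto simp: lat_def zero_complex.code intro!: hull_inc)
    ultimately show "empty_triangle u v"
      using D1 by (auto simp: empty_triangle_def collinear_lat_iff D)
  next
    assume e: "empty_triangle u v"
    then have D0: "D \<noteq> 0" by (simp add: empty_triangle_def collinear_lat_iff D)
    have vert: "p \<in> {(0, 0), u, v}" if "lat p \<in> convex hull {0, lat u, lat v}" for p
      using e that by (auto simp: empty_triangle_def)
    have span: "s \<in> \<int> \<and> t \<in> \<int>"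
      if p: "real_of_int p1 = s * u1 + t * v1" "real_of_int p2 = s * u2 + t * v2"
      for s t :: real and p1 p2 :: int
    proof -
      have main: "s = 0 \<and> t = 0"
        if st: "0 \<le> s" "s < 1" "0 \<le> t" "t < 1" "s + t \<le> 1"
          and p: "real_of_int p1 = s * u1 + t * v1" "real_of_int p2 = s * u2 + t * v2"
        for s t :: real and p1 p2 :: int
      proof -
        have "lat (p1, p2) \<in> convex hull {0, lat u, lat v}"
          unfolding in_triangle_iff using st p by (intro exI[of _ s] exI[of _ t]) (auto simp: uv)
        from vert[OF this] have "(p1, p2) \<in> {(0, 0), (u1, u2), (v1, v2)}" by (simp add: uv)
        then obtain m n :: int where mn: "m \<in> {0, 1}" "n \<in> {0, 1}"
          "p1 = m * u1 + n * v1" "p2 = m * u2 + n * v2"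
          by (auto intro: that[of 0 0] that[of 1 0] that[of 0 1])
        have 1: "(s - m) * u1 + (t - n) * v1 = 0" "(s - m) * u2 + (t - n) * v2 = 0"
          using p mn(3,4) by (simp_all add: algebra_simps)
        have "(s - m) * D = ((s - m) * u1 + (t - n) * v1) * v2 - ((s - m) * u2 + (t - n) * v2) * v1"
          "(t - n) * D = ((s - m) * u2 + (t - n) * v2) * u1 - ((s - m) * u1 + (t - n) * v1) * u2"
          unfolding D_def by (simp_all add: algebra_simps)
        then have "(s - m) * D = 0" "(t - n) * D = 0" unfolding 1 by simp_all
        then have "s = m" "t = n" using D0 by simp_all
        then show ?thesis using st mn(1,2) by auto
      qed
      define s' t' where "s' = frac s" and "t' = frac t"
      have r: "0 \<le> s'" "s' < 1" "0 \<le> t'" "t' < 1"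
        by (simp_all add: s'_def t'_def frac_lt_1)
      define q1 q2 where "q1 = p1 - \<lfloor>s\<rfloor> * u1 - \<lfloor>t\<rfloor> * v1" and "q2 = p2 - \<lfloor>s\<rfloor> * u2 - \<lfloor>t\<rfloor> * v2"
      have q: "real_of_int q1 = s' * u1 + t' * v1" "real_of_int q2 = s' * u2 + t' * v2"
        using p by (simp_all add: q1_def q2_def s'_def t'_def frac_def algebra_simps)
      have "s' = 0 \<and> t' = 0"
      proof (cases "s' + t' \<le> 1")
        case True
        then show ?thesis using main[OF r True q] by simp
      next
        case False
        have "1 - s' = 0 \<and> 1 - t' = 0"
          by (rule main[of _ _ "u1 + v1 - q1" "u2 + v2 - q2"])
            (use r False q in \<open>auto simp: algebra_simps\<close>)
        then show ?thesis using r by simp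
      qed
      then show ?thesis by (simp add: s'_def t'_def frac_eq_0_iff)
    qed
    have dvd: "D dvd x" if x: "real_of_int x / D \<in> \<int>" for x
    proof -
      obtain k where "real_of_int x / D = of_int k" using x by (rule Ints_cases)
      then have "real_of_int x = of_int (D * k)" using D0 by (simp add: field_simps)
      then show ?thesis by (metis dvd_triv_left of_int_eq_iff)
    qed
    have Dr: "real_of_int D = of_int u1 * of_int v2 - of_int u2 * of_int v1" by (simp add: D_def)
    have Dr0: "real_of_int D \<noteq> 0" using D0 by simp
    have a: "real_of_int v2 / D \<in> \<int> \<and> real_of_int (- u2) / D \<in> \<int>"
      by (rule span[of 1 _ _ 0])
        (use Dr Dr0 in \<open>simp_all add: field_simps\<close>)
    have b: "real_of_int (- v1) / D \<in> \<int> \<and> real_of_int u1 / D \<in> \<int>"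
      by (rule span[of 0 _ _ 1])
        (use Dr Dr0 in \<open>simp_all add: field_simps\<close>)
    have "D dvd v2" "D dvd - u2" "D dvd - v1" "D dvd u1" using a b dvd by blast+
    then have "D * D dvd u1 * v2 - u2 * v1" by (intro dvd_diff mult_dvd_mono) auto
    then have "D * D dvd D * 1" by (simp add: D_def)
    then have "D dvd 1" using D0 by (metis dvd_mult_cancel_left)
    then show "det2 u v \<in> {1, -1}" using D by (auto simp: zdvd1_eq)
  qed
qed

end

theory Submission
  imports Defs
begin

text \<open>
  Everything is a sum over the oriented sides of the polygon, and on a unimodular polygon the
  three invariants become very simple sums.

  The winding number of a closed polygon is the sum of the winding numbers of the triangles
  spanned by the origin and the sides, because the radial segments are traversed once in each
  direction. Integrating gives the shoelace formula (\<open>shoelace_winding_number\<close>), so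
  \<open>A\<close> is half the sum of the determinants. A unimodular side contains no
  lattice points but its ends, so it has lattice length one and \<open>B\<close> is the sum of the
  signs, which are the same determinants. Hence \<open>A = B / 2\<close>, which is one direction.

  Conversely, every pair consisting of a half-integer \<open>k / 2\<close> and an integer \<open>c\<close> has to
  occur as \<open>(A, C)\<close>. The normal of a unimodular side has inner product one with both ends of
  the side. So the normals and the vertices never drift apart by a right angle, and
  \<open>C\<close> is the number of turns that the vertices make around the origin
  (\<open>rotation_eq_winding_of_vertices\<close>). Both \<open>2 A\<close> and \<open>C\<close> are therefore additive when
  two loops with the same starting vertex are run through one after the other. The square with
  vertices \<open>\<plusminus> e1\<close>, \<open>\<plusminus> e2\<close> has \<open>(2 A, C) = (4, 1)\<close>, the triangle \<open>e1\<close>, \<open>e1 + e2\<close>, \<open>e2\<close>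
  has \<open>(1, 0)\<close>, reversing a loop changes both signs, and these vectors generate the whole
  integer lattice.
\<close>

section \<open>Edges of a closed polygon\<close>

text \<open>
  The sides are kept as a list of pairs, since then concatenating two loops based at the same
  point concatenates their lists of sides (\<open>edges_append\<close>).
\<close>

definition edges :: "'a list \<Rightarrow> ('a \<times> 'a) list" where
  "edges vs = zip vs (rotate1 vs)"

lemma length_edges [simp]: "length (edges vs) = length vs"
  by (simp add: edges_def)

lemma nth_edges: "i < length vs \<Longrightarrow> edges vs ! i = (vs ! i, vs ! (Suc i mod length vs))"
  by (simp add: edges_def nth_rotate1)

lemma set_edges: "set (edges vs) = (\<lambda>i. (vs ! i, vs ! (Suc i mod length vs))) ` {..<length vs}"
proof -
  have "set (edges vs) = (\<lambda>i. edges vs ! i) ` {..<length vs}"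
    using nth_image[of "length vs" "edges vs"] by (simp add: atLeast0LessThan)
  then show ?thesis by (simp add: nth_edges cong: image_cong_simp)
qed

lemma edges_map: "edges (map f vs) = map (map_prod f f) (edges vs)"
  by (simp add: edges_def rotate1_map zip_map_map map_prod_def case_prod_unfold)

lemma sum_list_edges:
  fixes f :: "'a \<Rightarrow> 'a \<Rightarrow> 'b::comm_monoid_add"
  shows "(\<Sum>(u, v)\<leftarrow>edges vs. f u v) = (\<Sum>i<length vs. f (vs ! i) (vs ! (Suc i mod length vs)))"
  by (simp add: sum_list_sum_nth atLeast0LessThan nth_edges case_prod_unfold)

lemma edges_append:
  assumes "vs \<noteq> []" "ws \<noteq> []" "hd vs = hd ws"
  shows "edges (vs @ ws) = edges vs @ edges ws"
  using assms by (cases vs; cases ws) (auto simp: edges_def simp flip: zip_append)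

lemma edges_telescope:
  fixes f :: "'a \<Rightarrow> 'b::ab_group_add"
  shows "(\<Sum>(u, v)\<leftarrow>edges vs. f u - f v) = 0"
proof -
  have *: "(\<Sum>(u, v)\<leftarrow>zip us ws. f u - f v) = sum_list (map f us) - sum_list (map f ws)"
    if "length us = length ws" for us ws
    using that by (induction us ws rule: list_induct2) (auto simp: algebra_simps)
  have "sum_list (map f (rotate1 vs)) = sum_list (map f vs)"
    by (cases vs) (auto simp: add.commute)
  then show ?thesis
    by (simp add: edges_def *)
qed

section \<open>The area of a triangle in the complex plane\<close>

text \<open>
  The area of a triangle is known for the coordinate space \<open>real ^ 2\<close>; this carries it over to
  the complex plane.
\<close>

lemma lborel_complex_eq_distr:
  "(lborel :: complex measure) = distr (lborel :: (real ^ 2) measure) borel (\<lambda>x. Complex (x $ 1) (x $ 2))"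
proof (rule lborel_eqI)
  have meas: "(\<lambda>x::real^2. Complex (x $ 1) (x $ 2)) \<in> borel_measurable borel"
    by (intro borel_measurable_continuous_onI continuous_intros)
  fix l u :: complex
  assume le: "\<And>b. b \<in> Basis \<Longrightarrow> l \<bullet> b \<le> u \<bullet> b"
  have le': "Re l \<le> Re u" "Im l \<le> Im u"
    using le[of 1] le[of \<i>] by (auto simp: Basis_complex_def)
  have basis: "(Basis :: (real^2) set) = {axis 1 1, axis 2 1}"
    unfolding Basis_vec_def UNIV_2 by auto
  have "(\<lambda>x::real^2. Complex (x $ 1) (x $ 2)) -` box l u = box (vector [Re l, Im l]) (vector [Re u, Im u])"
    by (auto simp: box_def Basis_complex_def Basis_vec_def inner_axis forall_2)
  then have "emeasure (distr (lborel :: (real ^ 2) measure) borel (\<lambda>x. Complex (x $ 1) (x $ 2))) (box l u)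
      = emeasure lborel (box (vector [Re l, Im l]) (vector [Re u, Im u]) :: (real^2) set)"
    using meas by (subst emeasure_distr) auto
  also have "\<dots> = ennreal (\<Prod>b\<in>Basis. (vector [Re u, Im u] - vector [Re l, Im l] :: real^2) \<bullet> b)"
    by (rule emeasure_lborel_box) (auto simp: basis inner_axis le')
  also have "(\<Prod>b\<in>Basis. (vector [Re u, Im u] - vector [Re l, Im l] :: real^2) \<bullet> b) = (\<Prod>b\<in>Basis. (u - l) \<bullet> b)"
    by (simp add: basis Basis_complex_def axis_eq_axis inner_axis)
  finally show "emeasure (distr (lborel :: (real ^ 2) measure) borel (\<lambda>x. Complex (x $ 1) (x $ 2))) (box l u)
      = ennreal (\<Prod>b\<in>Basis. (u - l) \<bullet> b)" .
qed simp

lemma measure_triangle_complex: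
  "measure lborel (convex hull {0, a, b :: complex}) = \<bar>Im (cnj a * b)\<bar> / 2"
proof -
  define g where "g = (\<lambda>x::real^2. Complex (x $ 1) (x $ 2))"
  define h where "h = (\<lambda>z::complex. vector [Re z, Im z] :: real^2)"
  have lin: "linear g"
    by (auto simp: g_def linear_iff complex_eq_iff)
  have g: "g \<in> borel_measurable borel"
    using lin linear_continuous_on[of g UNIV] by (intro borel_measurable_continuous_onI) (simp add: linear_conv_bounded_linear)
  have gh: "g (h z) = z" and hg: "h (g x) = x" for z x
    by (auto simp: g_def h_def vec_eq_iff forall_2)
  have inj: "inj g" by (metis hg injI)
  have "convex hull {0, a, b} = g ` (convex hull {0, h a, h b})"
    using convex_hull_linear_image[OF lin, of "{0, h a, h b}"] linear_0[OF lin] by (simp add: gh)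
  then have pre: "g -` (convex hull {0, a, b}) = convex hull {0, h a, h b}"
    by (simp add: inj_vimage_image_eq[OF inj])
  have "measure lborel (convex hull {0, a, b}) = measure (distr lborel borel g) (convex hull {0, a, b})"
    unfolding g_def lborel_complex_eq_distr[symmetric] ..
  also have "\<dots> = measure lborel (convex hull {0, h a, h b})"
    using g by (subst measure_distr)
      (auto simp: pre intro!: borel_closed compact_imp_closed finite_imp_compact_convex_hull)
  also have "\<dots> = \<bar>Im (cnj a * b)\<bar> / 2"
    by (simp add: content_triangle h_def abs_minus_commute algebra_simps)
  finally show ?thesis .
qed

section \<open>The shoelace formula for winding numbers\<close>

lemma winding_number_linepath_reverse:
  "z \<notin> closed_segment a b \<Longrightarrow> winding_number (linepath b a) z = - winding_number (linepath a b) z"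
  using winding_number_reversepath[of "linepath a b" z] by simp

text \<open>
  The number \<open>Im (cnj a * b)\<close> is the determinant of \<open>a\<close> and \<open>b\<close>, so its sign is the
  orientation of the triangle. For a degenerate triangle both sides vanish: there is no
  point of the triangle off its sides.
\<close>

lemma winding_number_triangle_origin:
  assumes "z \<notin> closed_segment 0 a" "z \<notin> closed_segment a b" "z \<notin> closed_segment b 0"
  shows "winding_number (linepath 0 a) z + winding_number (linepath a b) z + winding_number (linepath b 0) z
         = of_real (sgn (Im (cnj a * b)) * indicator (convex hull {0, a, b}) z)"
proof -
  let ?T = "linepath 0 a +++ linepath a b +++ linepath b 0"
  have sum: "winding_number ?T z
      = winding_number (linepath 0 a) z + winding_number (linepath a b) z + winding_number (linepath b 0) z"
    using assms by (simp add: winding_number_join path_image_join)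
  show ?thesis
  proof (cases "z \<in> convex hull {0, a, b}")
    case False
    have "closed_segment 0 a \<subseteq> convex hull {0, a, b}" "closed_segment a b \<subseteq> convex hull {0, a, b}"
      "closed_segment b 0 \<subseteq> convex hull {0, a, b}"
      unfolding segment_convex_hull by (auto intro!: hull_mono)
    then have "winding_number ?T z = 0"
      using False by (intro winding_number_zero_outside[of _ "convex hull {0, a, b}"])
        (auto simp: path_image_join)
    then show ?thesis using sum False by simp
  next
    case True
    then have z: "z \<in> interior (convex hull {0, a, b})"
      using assms by (subst interior_of_triangle) (auto simp: closed_segment_commute)
    \<comment> \<open>The three terms on the right are twice the signed areas of the triangles that \<open>z\<close> spans
      with the sides. They have a common sign, which must then be that of the determinant.\<close>
    have area: "Im (cnj a * b) = Im ((a - 0) * cnj (a - z)) + Im ((b - a) * cnj (b - z)) + Im ((0 - b) * cnj (0 - z))"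
      by (simp add: algebra_simps)
    show ?thesis
      using winding_number_triangle[OF z] wn_triangle2[OF z] area True unfolding sum
      by (auto simp: algebra_simps sgn_if)
  qed
qed

lemma polygonal_path_basics:
  assumes "xs \<noteq> []"
  shows "path (polygonal_path xs)" "pathstart (polygonal_path xs) = hd xs"
    "pathfinish (polygonal_path xs) = last xs"
  using assms by (induction xs rule: polygonal_path.induct) auto

lemma winding_number_polygonal_path:
  assumes "length xs \<ge> 2"
  shows "path_image (polygonal_path xs) = (\<Union>(a, b)\<in>set (zip xs (tl xs)). closed_segment a b)"
    "z \<notin> path_image (polygonal_path xs) \<Longrightarrow>
      winding_number (polygonal_path xs) z = (\<Sum>(a, b)\<leftarrow>zip xs (tl xs). winding_number (linepath a b) z)"
  using assms
proof (induction xs rule: polygonal_path.induct)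
  case (4 x y z zs)
  { case 1 then show ?case using 4 by (simp add: path_image_join polygonal_path_basics) }
  { case 2 then show ?case using 4
    by (simp add: winding_number_join path_image_join polygonal_path_basics) }
qed auto

lemma zip_tl_closed: "vs \<noteq> [] \<Longrightarrow> zip (vs @ [hd vs]) (tl (vs @ [hd vs])) = edges vs"
proof (cases vs)
  case (Cons x xs)
  then show ?thesis
    using zip_append[of "x # xs" "xs @ [x]" "[x]" "[]"] by (simp add: edges_def del: zip_append)
qed simp

lemma winding_number_closed_polygon:
  fixes vs :: "complex list"
  assumes "vs \<noteq> []"
  defines "\<gamma> \<equiv> polygonal_path (vs @ [hd vs])"
  shows "path_image \<gamma> = (\<Union>(a, b)\<in>set (edges vs). closed_segment a b)"
    "z \<notin> path_image \<gamma> \<Longrightarrow> winding_number \<gamma> z = (\<Sum>(a, b)\<leftarrow>edges vs. winding_number (linepath a b) z)"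
proof -
  have len: "2 \<le> length (vs @ [hd vs])"
    using assms(1) by (cases vs) auto
  note * = winding_number_polygonal_path[OF len, unfolded zip_tl_closed[OF assms(1)]]
  show "path_image \<gamma> = (\<Union>(a, b)\<in>set (edges vs). closed_segment a b)"
    unfolding \<gamma>_def by (rule *(1))
  show "winding_number \<gamma> z = (\<Sum>(a, b)\<leftarrow>edges vs. winding_number (linepath a b) z)"
    if "z \<notin> path_image \<gamma>"
    using that unfolding \<gamma>_def by (rule *(2))
qed

lemma null_sets_closed_segment: "closed_segment a (b::complex) \<in> null_sets lborel"
proof -
  have "negligible (closed_segment a b)"
    by (simp add: negligible_convex_interior interior_closed_segment_ge2)
  then show ?thesis
    by (simp add: negligible_iff_null_sets null_sets_completion_iff)
qed

text \<open>
  Almost every point lies neither on the polygon nor on a segment from the origin to a vertex.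
  At such a point the winding number is the sum of the oriented indicator functions \<open>T\<close> of the
  triangles with apex at the origin, and each of these integrates to half a determinant.
\<close>

theorem shoelace_winding_number:
  fixes vs :: "complex list"
  assumes "vs \<noteq> []"
  defines "\<gamma> \<equiv> polygonal_path (vs @ [hd vs])"
  shows "set_lebesgue_integral lborel (- path_image \<gamma>) (\<lambda>z. Re (winding_number \<gamma> z))
         = (\<Sum>(a, b)\<leftarrow>edges vs. Im (cnj a * b)) / 2"
proof -
  define S where "S = (\<lambda>(a, b :: complex). Im (cnj a * b) / 2)"
  define T where "T = (\<lambda>(a, b) z. sgn (Im (cnj a * b)) * indicator (convex hull {0, a, b :: complex}) z)"
  have path: "path \<gamma>" unfolding \<gamma>_def by (rule polygonal_path_basics) simp
  have img: "path_image \<gamma> = (\<Union>(a, b)\<in>set (edges vs). closed_segment a b)"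
    unfolding \<gamma>_def by (rule winding_number_closed_polygon(1)[OF assms(1)])
  have T: "integrable lborel (T e)" "integral\<^sup>L lborel (T e) = S e" for e
  proof -
    obtain a b where e: "e = (a, b)" by fastforce
    have c: "compact (convex hull {0, a, b})" by (intro finite_imp_compact_convex_hull) auto
    have s: "convex hull {0, a, b} \<in> sets lborel" using c by (auto intro: borel_closed compact_imp_closed)
    have f: "emeasure lborel (convex hull {0, a, b}) < \<infinity>" using c by (rule emeasure_compact_finite)
    show "integrable lborel (T e)" unfolding e T_def using s f by simp
    have "integral\<^sup>L lborel (T e) = sgn (Im (cnj a * b)) * measure lborel (convex hull {0, a, b})"
      unfolding e T_def using s f by (simp del: complex_cnj_mult)
    also have "\<dots> = Im (cnj a * b) / 2"
      unfolding measure_triangle_complex by (simp only: times_divide_eq_right sgn_mult_abs)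
    finally show "integral\<^sup>L lborel (T e) = S e"
      unfolding e S_def by (simp only: prod.case)
  qed
  have "AE z in lborel. z \<notin> path_image \<gamma> \<and> (\<forall>a\<in>set vs. z \<notin> closed_segment 0 a)"
  proof -
    have "path_image \<gamma> \<union> (\<Union>a\<in>set vs. closed_segment 0 a) \<in> null_sets lborel"
      unfolding img
      by (intro null_sets.Un null_sets.finite_UN) (auto intro: null_sets_closed_segment)
    from AE_not_in[OF this] show ?thesis by eventually_elim auto
  qed
  then have ae: "AE z in lborel. indicator (- path_image \<gamma>) z *\<^sub>R Re (winding_number \<gamma> z) = (\<Sum>e\<leftarrow>edges vs. T e z)"
  proof eventually_elim
    case (elim z)
    have in_vs: "a \<in> set vs \<and> b \<in> set vs" if "(a, b) \<in> set (edges vs)" for a b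
      using that by (auto simp: edges_def dest: set_zip_leftD set_zip_rightD)
    have "winding_number \<gamma> z = (\<Sum>(a, b)\<leftarrow>edges vs. winding_number (linepath a b) z)"
      using elim winding_number_closed_polygon(2)[OF assms(1)] unfolding \<gamma>_def by blast
    \<comment> \<open>The radial segments to the two ends of every side are inserted; they cancel cyclically.\<close>
    also have "\<dots> = (\<Sum>(a, b)\<leftarrow>edges vs. winding_number (linepath a b) z)
        + (\<Sum>(a, b)\<leftarrow>edges vs. winding_number (linepath 0 a) z - winding_number (linepath 0 b) z)"
      by (simp add: edges_telescope)
    also have "\<dots> = (\<Sum>(a, b)\<leftarrow>edges vs. winding_number (linepath a b) z
        + (winding_number (linepath 0 a) z - winding_number (linepath 0 b) z))"
      by (simp add: case_prod_unfold sum_list_addf)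
    also have "\<dots> = (\<Sum>e\<leftarrow>edges vs. complex_of_real (T e z))"
    proof (intro arg_cong[of _ _ sum_list] map_cong refl)
      fix e assume e: "e \<in> set (edges vs)"
      obtain a b where ab: "e = (a, b)" by fastforce
      have "z \<notin> closed_segment 0 a" "z \<notin> closed_segment a b" "z \<notin> closed_segment 0 b"
        using elim e in_vs[of a b] by (auto simp: ab img)
      then show "(case e of (a, b) \<Rightarrow> winding_number (linepath a b) z
        + (winding_number (linepath 0 a) z - winding_number (linepath 0 b) z)) = complex_of_real (T e z)"
        using winding_number_triangle_origin[of z a b] winding_number_linepath_reverse[of z 0 b]
        by (simp add: ab T_def closed_segment_commute[of b 0] algebra_simps)
    qed
    also have "\<dots> = of_real (\<Sum>e\<leftarrow>edges vs. T e z)"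
      by (simp add: sum_list_sum_nth)
    finally show ?case using elim by simp
  qed
  have meas: "(\<lambda>z. indicator (- path_image \<gamma>) z *\<^sub>R Re (winding_number \<gamma> z)) \<in> borel_measurable lborel"
    unfolding measurable_lborel2
  proof (rule borel_measurable_continuous_on_indicator)
    show "- path_image \<gamma> \<in> sets borel"
      using closed_path_image[OF path] by (intro borel_open) (simp add: open_Compl)
    show "continuous_on (- path_image \<gamma>) (\<lambda>z. Re (winding_number \<gamma> z))"
      by (intro continuous_intros continuous_on_winding_number path)
  qed
  have int: "integrable lborel (\<lambda>z. \<Sum>e\<leftarrow>es. T e z)
      \<and> integral\<^sup>L lborel (\<lambda>z. \<Sum>e\<leftarrow>es. T e z) = (\<Sum>e\<leftarrow>es. S e)" for es
  proof (induction es)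
    case (Cons e es)
    then show ?case
      using T[of e] by simp
  qed simp
  have "(\<integral>z. indicator (- path_image \<gamma>) z *\<^sub>R Re (winding_number \<gamma> z) \<partial>lborel)
      = (\<integral>z. (\<Sum>e\<leftarrow>edges vs. T e z) \<partial>lborel)"
    using int[of "edges vs"] by (intro integral_cong_AE meas ae borel_measurable_integrable) (rule conjunct1)
  moreover have "(\<Sum>e\<leftarrow>es. S e) = (\<Sum>(a, b)\<leftarrow>es. Im (cnj a * b)) / 2" for es
    by (induction es) (auto simp: S_def add_divide_distrib)
  ultimately show ?thesis
    unfolding set_lebesgue_integral_def using int[of "edges vs"] by simp
qed

section \<open>Unimodular polygons\<close>

lemma sum_vtx_eq_edges:
  fixes f :: "int \<times> int \<Rightarrow> int \<times> int \<Rightarrow> 'b::comm_monoid_add"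
  shows "(\<Sum>i<length (verts P). f (vtx P i) (vtx P (i + 1))) = (\<Sum>(u, v)\<leftarrow>edges (verts P). f u v)"
  by (simp add: sum_list_edges vtx_def)

lemma area_eq_half_sum_det2:
  assumes "verts P \<noteq> []"
  shows "area_A P = (\<Sum>(u, v)\<leftarrow>edges (verts P). real_of_int (det2 u v)) / 2"
proof -
  let ?vs = "map lat (verts P)"
  have loop: "loop P = polygonal_path (?vs @ [hd ?vs])"
    using assms by (simp add: loop_def hd_map)
  have "(\<Union>i<length (verts P). side P i) = (\<Union>(a, b)\<in>set (edges ?vs). closed_segment a b)"
    by (simp add: side_def vtx_def edges_map set_edges case_prod_unfold)
  also have "\<dots> = path_image (loop P)"
    unfolding loop by (rule winding_number_closed_polygon(1)[symmetric]) (use assms in simp)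
  finally have "area_A P = (\<Sum>(a, b)\<leftarrow>edges ?vs. Im (cnj a * b)) / 2"
    unfolding area_A_def using shoelace_winding_number[of ?vs] assms by (simp add: loop)
  also have "(\<Sum>(a, b)\<leftarrow>edges ?vs. Im (cnj a * b)) = (\<Sum>(u, v)\<leftarrow>edges (verts P). real_of_int (det2 u v))"
    by (simp add: edges_map o_def case_prod_unfold lat_def det2_def)
  finally show ?thesis .
qed

lemma det2_on_segment:
  assumes "lat v \<in> closed_segment (lat u) (lat w)"
  shows "\<exists>t. 0 \<le> t \<and> t \<le> 1 \<and> (\<forall>x. real_of_int (det2 x v) = (1 - t) * real_of_int (det2 x u) + t * real_of_int (det2 x w))"
proof -
  obtain t where t: "0 \<le> t" "t \<le> 1" "lat v = (1 - t) *\<^sub>R lat u + t *\<^sub>R lat w"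
    using assms by (auto simp: closed_segment_def)
  then have *: "real_of_int (fst v) = (1 - t) * fst u + t * fst w" "real_of_int (snd v) = (1 - t) * snd u + t * snd w"
    by (simp_all add: lat_def complex_eq_iff)
  then have "real_of_int (det2 x v) = (1 - t) * real_of_int (det2 x u) + t * real_of_int (det2 x w)" for x
    by (simp only: det2_def of_int_diff of_int_mult *) (simp add: algebra_simps)
  then show ?thesis using t by blast
qed

lemma det2_swap: "det2 v u = - det2 u v" and det2_self: "det2 u u = 0"
  by (simp_all add: det2_def)

text \<open>
  The side is part of the triangle that it spans with the origin. The only lattice points there
  are the three vertices, and the origin is not on the line through \<open>u\<close> and \<open>v\<close>.
\<close>

lemma lattice_length_eq_1:
  assumes "det2 u v \<in> {1, -1}"
  shows "lattice_length u v = 1"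
proof -
  have "{p. lat p \<in> closed_segment (lat u) (lat v)} = {u, v}" (is "?S = _")
  proof
    have "closed_segment (lat u) (lat v) \<subseteq> convex hull {0, lat u, lat v}"
      unfolding segment_convex_hull by (auto intro!: hull_mono)
    moreover have "{p. lat p \<in> convex hull {0, lat u, lat v}} = {(0, 0), u, v}"
      using assms empty_triangle_iff_det2[of u v] by (simp add: empty_triangle_def)
    ultimately have "?S \<subseteq> {(0, 0), u, v}" by blast
    moreover have "(0, 0) \<notin> ?S"
    proof
      assume "(0, 0) \<in> ?S"
      then obtain t where "\<And>x. real_of_int (det2 x (0, 0)) = (1 - t) * real_of_int (det2 x u) + t * real_of_int (det2 x v)"
        using det2_on_segment by blast
      from this[of u] this[of v] show False
        using assms by (auto simp: det2_self det2_swap[of v u]) (auto simp: det2_def)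
    qed
    ultimately show "?S \<subseteq> {u, v}" by auto
  qed auto
  moreover have "u \<noteq> v" using assms by (auto simp: det2_def)
  ultimately show ?thesis by (simp add: lattice_length_def)
qed

lemma unimodular_sides:
  assumes "unimodular_multi_polygon P"
  shows "verts P \<noteq> []" "det2 (vtx P i) (vtx P (i + 1)) \<in> {1, -1}"
    "sgn_side P i = det2 (vtx P i) (vtx P (i + 1))"
proof -
  let ?d = "length (verts P)"
  show ne: "verts P \<noteq> []"
    using assms by (auto simp: unimodular_multi_polygon_def lattice_multi_polygon_def)
  have mod: "vtx P (i mod ?d) = vtx P i" "vtx P (i mod ?d + 1) = vtx P (i + 1)"
     "sgn_side P (i mod ?d) = sgn_side P i"
    by (simp_all add: vtx_def sgn_side_def mod_Suc_eq)
  have lt: "i mod ?d < ?d" using ne by simp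
  show "sgn_side P i = det2 (vtx P i) (vtx P (i + 1))"
    using assms lt mod unfolding unimodular_multi_polygon_def by metis
  then show "det2 (vtx P i) (vtx P (i + 1)) \<in> {1, -1}"
  proof -
    have "sgn_side P (i mod ?d) \<in> {1, -1}"
      using assms lt unfolding unimodular_multi_polygon_def lattice_multi_polygon_def by blast
    then show ?thesis
      using \<open>sgn_side P i = _\<close> by (simp add: mod)
  qed
qed

lemma boundary_eq_sum_det2:
  assumes "unimodular_multi_polygon P"
  shows "boundary_B P = (\<Sum>(u, v)\<leftarrow>edges (verts P). det2 u v)"
proof -
  have "boundary_B P = (\<Sum>i<length (verts P). det2 (vtx P i) (vtx P (i + 1)))"
    unfolding boundary_B_def using unimodular_sides[OF assms]
    by (intro sum.cong) (auto simp: lattice_length_eq_1)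
  then show ?thesis by (simp only: sum_vtx_eq_edges)
qed

lemma area_eq_half_boundary:
  assumes "unimodular_multi_polygon P"
  shows "area_A P = 1 / 2 * real_of_int (boundary_B P)"
proof -
  have "area_A P = (\<Sum>(u, v)\<leftarrow>edges (verts P). real_of_int (det2 u v)) / 2"
    by (rule area_eq_half_sum_det2[OF unimodular_sides(1)[OF assms]])
  also have "\<dots> = 1 / 2 * real_of_int (boundary_B P)"
    unfolding boundary_eq_sum_det2[OF assms] by (simp add: sum_list_of_int[symmetric] o_def case_prod_unfold)
  finally show ?thesis .
qed

section \<open>The rotation number\<close>

lemma Arg_mult_right_half_plane:
  assumes "Re z > 0" "Re w > 0"
  shows "Arg (z * w) = Arg z + Arg w"
proof -
  have "\<bar>Arg z\<bar> < pi / 2" "\<bar>Arg w\<bar> < pi / 2" using Arg_Re_pos[of z] Arg_Re_pos[of w] assms by blast+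
  then show ?thesis using assms by (intro Arg_times) auto
qed

lemma Re_divide_swap: "Re (z / w) > 0 \<longleftrightarrow> Re (w / z) > 0"
  by (simp add: Re_complex_div_gt_0 mult.commute)

text \<open>
  Quotients with positive real part express an angle of less than a right angle. Both inner
  products equal \<open>D * D\<close> for the determinant \<open>D\<close> of the side: one factor comes from the normal
  to the vector \<open>v - u\<close>, and the other is the sign in the definition of the normal.
\<close>

lemma normal_in_half_planes:
  assumes "unimodular_multi_polygon P"
  shows "Re (normal P i / lat (vtx P i)) > 0" "Re (normal P i / lat (vtx P (i + 1))) > 0"
proof -
  let ?D = "det2 (vtx P i) (vtx P (i + 1))"
  have "?D * ?D = 1" using unimodular_sides(2)[OF assms, of i] by auto
  then have D: "real_of_int ?D * real_of_int ?D = 1" by (metis of_int_1 of_int_mult)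
  have "Re (normal P i * cnj (lat (vtx P i))) = real_of_int ?D * real_of_int ?D"
    "Re (normal P i * cnj (lat (vtx P (i + 1)))) = real_of_int ?D * real_of_int ?D"
    unfolding normal_def unimodular_sides(3)[OF assms]
    by (simp_all add: lat_def det2_def algebra_simps)
  then show "Re (normal P i / lat (vtx P i)) > 0" "Re (normal P i / lat (vtx P (i + 1))) > 0"
    unfolding D by (simp_all add: Re_complex_div_gt_0)
qed

text \<open>
  The step from one normal to the next passes through the common vertex, and the step from one
  vertex to the next passes through the normal between them. In both cases the two partial
  turns are less than a right angle, so the arguments add up without a correction by a multiple
  of \<open>2 * pi\<close>. The two cyclic sums consist of the same partial turns.
\<close>

lemma rotation_eq_winding_of_vertices:
  assumes "unimodular_multi_polygon P"
  shows "rotation_C P = (\<Sum>(u, v)\<leftarrow>edges (verts P). Arg (lat v / lat u)) / (2 * pi)"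
proof -
  let ?d = "length (verts P)" and ?v = "\<lambda>i. lat (vtx P i)" and ?n = "normal P"
  define f where "f i = Arg (?n i / ?v i)" for i
  define g where "g i = Arg (?v (i + 1) / ?n i)" for i
  note pos = normal_in_half_planes[OF assms]
  have pos': "Re (?v (i + 1) / ?n i) > 0" for i
    using pos(2)[of i] by (simp add: Re_divide_swap)
  have nz: "?n i \<noteq> 0" "?v i \<noteq> 0" for i
    using pos(1)[of i] by auto
  have n: "Arg (?n (i + 1) / ?n i) = g i + f (i + 1)" for i
    using Arg_mult_right_half_plane[OF pos'[of i] pos(1)[of "i + 1"]] nz[of "i + 1"]
    by (simp add: f_def g_def)
  have v: "Arg (?v (i + 1) / ?v i) = f i + g i" for i
    using Arg_mult_right_half_plane[OF pos(1)[of i] pos'[of i]] nz[of i]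
    by (simp add: f_def g_def)
  have "f ?d = f 0" by (simp add: f_def normal_def vtx_def sgn_side_def mod_Suc)
  then have "(\<Sum>i<?d. f (i + 1)) = (\<Sum>i<?d. f i)"
    using sum.lessThan_Suc_shift[of f ?d] by simp
  then have "(\<Sum>i<?d. Arg (?n (i + 1) / ?n i)) = (\<Sum>i<?d. Arg (?v (i + 1) / ?v i))"
    unfolding n v by (simp add: sum.distrib)
  then show ?thesis
    using sum_vtx_eq_edges[of "\<lambda>u v. Arg (lat v / lat u)" P] by (simp add: rotation_C_def)
qed

section \<open>Realizing all values of the area and the rotation number\<close>

definition det2_polygon :: "(int \<times> int) list \<Rightarrow> multi_polygon" where
  "det2_polygon vs = \<lparr>verts = vs, signs = map (\<lambda>(u, v). det2 u v) (edges vs)\<rparr>"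

text \<open>
  The conditions on collinear sides in the definition of a lattice multi-polygon hold
  automatically for the signs given by determinants: the sign tells on which side of the
  direction of travel the origin lies, and it changes exactly when the direction of travel is reversed.
\<close>

lemma det2_signs_on_line:
  assumes "det2 u v \<in> {1, -1}" "det2 v w \<in> {1, -1}"
  shows "lat v \<in> closed_segment (lat u) (lat w) \<Longrightarrow> det2 u v = det2 v w"
    and "lat u \<in> closed_segment (lat v) (lat w) \<Longrightarrow> det2 u v \<noteq> det2 v w"
    and "lat w \<in> closed_segment (lat u) (lat v) \<Longrightarrow> det2 u v \<noteq> det2 v w"
proof -
  assume "lat v \<in> closed_segment (lat u) (lat w)"
  then obtain t where t: "0 \<le> t" "t \<le> 1"
    "\<And>x. real_of_int (det2 x v) = (1 - t) * real_of_int (det2 x u) + t * real_of_int (det2 x w)"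
    using det2_on_segment by blast
  have "real_of_int (det2 u v) = t * real_of_int (det2 u w)"
    "real_of_int (det2 v w) = (1 - t) * real_of_int (det2 u w)"
    using t(3)[of u] t(3)[of w] by (simp_all add: det2_self det2_swap[of w v] det2_swap[of w u])
  then have "real_of_int (det2 u v) * real_of_int (det2 v w) = t * (1 - t) * (real_of_int (det2 u w))\<^sup>2"
    by (simp add: power2_eq_square)
  also have "\<dots> \<ge> 0" using t(1,2) by simp
  finally show "det2 u v = det2 v w"
    using assms by auto
next
  assume "lat u \<in> closed_segment (lat v) (lat w)"
  then obtain t where t: "0 \<le> t" "t \<le> 1"
    "\<And>x. real_of_int (det2 x u) = (1 - t) * real_of_int (det2 x v) + t * real_of_int (det2 x w)"
    using det2_on_segment by blast
  have "- real_of_int (det2 u v) = t * real_of_int (det2 v w)"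
    using t(3)[of v] by (simp add: det2_self det2_swap[of v u])
  then show "det2 u v \<noteq> det2 v w"
    using assms t(1) by (elim insertE emptyE) simp_all
next
  assume "lat w \<in> closed_segment (lat u) (lat v)"
  then obtain t where t: "0 \<le> t" "t \<le> 1"
    "\<And>x. real_of_int (det2 x w) = (1 - t) * real_of_int (det2 x u) + t * real_of_int (det2 x v)"
    using det2_on_segment by blast
  have "real_of_int (det2 v w) = - (1 - t) * real_of_int (det2 u v)"
    using t(3)[of v] by (simp add: det2_self det2_swap[of v u] algebra_simps)
  then show "det2 u v \<noteq> det2 v w"
    using assms t(2) by (elim insertE emptyE) simp_all
qed

lemma unimodular_det2_polygon:
  assumes "2 \<le> length vs" "\<And>u v. (u, v) \<in> set (edges vs) \<Longrightarrow> det2 u v \<in> {1, -1}"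
  shows "unimodular_multi_polygon (det2_polygon vs)"
proof -
  let ?P = "det2_polygon vs"
  have V [simp]: "verts ?P = vs" by (simp add: det2_polygon_def)
  have ne: "length vs > 0" using assms(1) by linarith
  have vtx: "vtx ?P i = vs ! (i mod length vs)" for i by (simp add: vtx_def)
  have edge: "(vtx ?P i, vtx ?P (i + 1)) = edges vs ! (i mod length vs)" for i
    using ne by (simp add: nth_edges vtx mod_Suc_eq)
  have det: "det2 (vtx ?P i) (vtx ?P (i + 1)) \<in> {1, -1}" for i
    using ne by (intro assms(2)) (simp only: edge, simp)
  have sgn: "sgn_side ?P i = det2 (vtx ?P i) (vtx ?P (i + 1))" for i
    using ne edge[of i] by (simp add: sgn_side_def det2_polygon_def flip: edge)
  have "vtx ?P i \<noteq> vtx ?P (i + 1)" for i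
    using det[of i] by (auto simp: det2_self)
  moreover have det': "det2 (vtx ?P (i + 1)) (vtx ?P (i + 2)) \<in> {1, -1}" for i
    using det[of "i + 1"] by simp
  moreover have sgn': "sgn_side ?P (i + 1) = det2 (vtx ?P (i + 1)) (vtx ?P (i + 2))" for i
    using sgn[of "i + 1"] by simp
  moreover have side': "side ?P (i + 1) = closed_segment (lat (vtx ?P (i + 1))) (lat (vtx ?P (i + 2)))" for i
    by (simp add: side_def)
  moreover have "length (signs ?P) = length (verts ?P)" "verts ?P \<noteq> []"
    using ne by (simp_all add: det2_polygon_def)
  ultimately have "lattice_multi_polygon ?P"
    using det det2_signs_on_line[OF det det']
    unfolding lattice_multi_polygon_def sgn' side' unfolding sgn side_def[of ?P] by blast
  moreover have "unimodular_seq vs"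
  proof -
    have "det2 (vs ! i) (vs ! ((i + 1) mod length vs)) \<in> {1, -1}" if "i < length vs" for i
      by (rule assms(2)) (use that in \<open>simp add: set_edges\<close>)
    then show ?thesis
      unfolding unimodular_seq_def empty_triangle_iff_det2 using assms(1) by blast
  qed
  ultimately show ?thesis
    by (simp add: unimodular_multi_polygon_def sgn)
qed

text \<open>
  The pair \<open>(k, c)\<close> stands for \<open>(2 A, C)\<close>. The base point is fixed so that any two loops can be
  concatenated.
\<close>

definition realizable :: "int \<Rightarrow> int \<Rightarrow> bool" where
  "realizable k c \<longleftrightarrow> (\<exists>vs. 2 \<le> length vs \<and> hd vs = (1, 0) \<and>
     (\<forall>(u, v)\<in>set (edges vs). det2 u v \<in> {1, -1}) \<and>
     (\<Sum>(u, v)\<leftarrow>edges vs. det2 u v) = k \<and>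
     (\<Sum>(u, v)\<leftarrow>edges vs. Arg (lat v / lat u)) = 2 * pi * of_int c)"

lemma realizable_add:
  assumes "realizable k c" "realizable l d"
  shows "realizable (k + l) (c + d)"
proof -
  obtain vs where vs: "2 \<le> length vs" "hd vs = (1, 0)" "\<forall>(u, v)\<in>set (edges vs). det2 u v \<in> {1, -1}"
    "(\<Sum>(u, v)\<leftarrow>edges vs. det2 u v) = k" "(\<Sum>(u, v)\<leftarrow>edges vs. Arg (lat v / lat u)) = 2 * pi * of_int c"
    using assms(1) unfolding realizable_def by auto
  obtain ws where ws: "2 \<le> length ws" "hd ws = (1, 0)" "\<forall>(u, v)\<in>set (edges ws). det2 u v \<in> {1, -1}"
    "(\<Sum>(u, v)\<leftarrow>edges ws. det2 u v) = l" "(\<Sum>(u, v)\<leftarrow>edges ws. Arg (lat v / lat u)) = 2 * pi * of_int d"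
    using assms(2) unfolding realizable_def by auto
  have "vs \<noteq> []" "ws \<noteq> []" using vs(1) ws(1) by auto
  then have "edges (vs @ ws) = edges vs @ edges ws"
    using vs(2) ws(2) by (intro edges_append) auto
  then show ?thesis
    unfolding realizable_def using vs ws \<open>vs \<noteq> []\<close>
    by (intro exI[of _ "vs @ ws"]) (auto simp: ring_distribs)
qed

lemma Arg_neg_i: "Arg (- \<i>) = - (pi / 2)"
  using Arg_minus[of \<i>] by simp

text \<open>
  The blocks are a segment run back and forth, a square around the origin, and a triangle of area
  \<open>1 / 2\<close> that does not surround the origin, the last two in both orientations.
\<close>

lemma realizable_blocks:
  "realizable 0 0" "realizable 4 1" "realizable (- 4) (- 1)" "realizable 1 0" "realizable (- 1) 0"
proof -
  have lat: "lat (1, 0) = 1" "lat (0, 1) = \<i>" "lat (-1, 0) = -1" "lat (0, -1) = -\<i>" "lat (1, 1) = 1 + \<i>"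
    by (simp_all add: lat_def complex_eq_iff)
  have div: "\<i> / (1 + \<i>) = (1 + \<i>) / 2" "- (\<i> * (1 + \<i>)) = 1 - \<i>" "1 / (1 + \<i>) = (1 - \<i>) / 2"
    by (simp_all add: complex_eq_iff Re_divide Im_divide power2_eq_square)
  have half: "Arg (z / 2) = Arg z" for z
    using Arg_divide_of_real[of 2 z] by simp
  have "Arg ((1 + \<i>) * (1 + \<i>)) = Arg (1 + \<i>) + Arg (1 + \<i>)" "Arg ((1 - \<i>) * (1 - \<i>)) = Arg (1 - \<i>) + Arg (1 - \<i>)"
    by (simp_all add: Arg_mult_right_half_plane)
  moreover have "(1 + \<i>) * (1 + \<i>) = of_real 2 * \<i>" "(1 - \<i>) * (1 - \<i>) = of_real 2 * - \<i>"
    by (simp_all add: complex_eq_iff)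
  ultimately have quarter: "Arg (1 + \<i>) = pi / 4" "Arg (1 - \<i>) = - (pi / 4)"
    by (simp_all only: Arg_times_of_real zero_less_numeral) (simp_all add: Arg_neg_i)
  note defs = realizable_def edges_def det2_def lat div half quarter Arg_neg_i
  show "realizable 0 0"
    unfolding realizable_def by (rule exI[of _ "[(1,0), (0,1)]"]) (simp add: defs)
  show "realizable 4 1"
    unfolding realizable_def by (rule exI[of _ "[(1,0), (0,1), (-1,0), (0,-1)]"]) (simp add: defs)
  show "realizable (- 4) (- 1)"
    unfolding realizable_def by (rule exI[of _ "[(1,0), (0,-1), (-1,0), (0,1)]"]) (simp add: defs)
  show "realizable 1 0"
    unfolding realizable_def by (rule exI[of _ "[(1,0), (1,1), (0,1)]"]) (simp add: defs)
  show "realizable (- 1) 0"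
    unfolding realizable_def by (rule exI[of _ "[(1,0), (0,1), (1,1)]"]) (simp add: defs)
qed

lemma realizable_multiple:
  assumes "realizable k c" "realizable (- k) (- c)"
  shows "realizable (n * k) (n * c)"
proof -
  have *: "realizable (int m * k) (int m * c)" if "realizable k c" for m k c
  proof (induction m)
    case (Suc m)
    then show ?case using realizable_add[OF that] by (simp add: ring_distribs)
  qed (simp add: realizable_blocks)
  show ?thesis
    using *[OF assms(1), of "nat n"] *[OF assms(2), of "nat (- n)"] by (cases "n \<ge> 0") auto
qed

text \<open>The square \<open>c\<close> times, then the small triangle \<open>k - 4 * c\<close> times to correct the area.\<close>

lemma realizable_all: "realizable k c"
  using realizable_add[OF realizable_multiple[of 4 1 c] realizable_multiple[of 1 0 "k - 4 * c"]]
    realizable_blocks by simp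

theorem theorem4p4:
  fixes a b c :: real
  assumes "(a, b, c) \<in> triples_A"
  shows "(\<exists>P. unimodular_multi_polygon P \<and>
            (a, b, c) = (area_A P, 1 / 2 * real_of_int (boundary_B P), rotation_C P))
         \<longleftrightarrow> a = b"
proof
  assume "\<exists>P. unimodular_multi_polygon P \<and>
    (a, b, c) = (area_A P, 1 / 2 * real_of_int (boundary_B P), rotation_C P)"
  then obtain P where P: "unimodular_multi_polygon P"
    "a = area_A P" "b = 1 / 2 * real_of_int (boundary_B P)" by auto
  show "a = b" unfolding P(2,3) by (rule area_eq_half_boundary[OF P(1)])
next
  assume "a = b"
  obtain k m where km: "2 * a = of_int k" "c = of_int m"
    using assms by (auto simp: triples_A_def elim!: Ints_cases)
  obtain vs where vs: "2 \<le> length vs" "\<forall>(u, v)\<in>set (edges vs). det2 u v \<in> {1, -1}"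
    "(\<Sum>(u, v)\<leftarrow>edges vs. det2 u v) = k"
    "(\<Sum>(u, v)\<leftarrow>edges vs. Arg (lat v / lat u)) = 2 * pi * of_int m"
    using realizable_all[of k m] unfolding realizable_def by auto
  let ?P = "det2_polygon vs"
  have P: "unimodular_multi_polygon ?P" using vs(1,2) by (intro unimodular_det2_polygon) auto
  have "verts ?P = vs" by (simp add: det2_polygon_def)
  then have B: "boundary_B ?P = k" and C: "rotation_C ?P = m"
    using boundary_eq_sum_det2[OF P] rotation_eq_winding_of_vertices[OF P] vs(3,4) by simp_all
  have A: "area_A ?P = k / 2"
    using area_eq_half_boundary[OF P] B by simp
  show "\<exists>P. unimodular_multi_polygon P \<and>
    (a, b, c) = (area_A P, 1 / 2 * real_of_int (boundary_B P), rotation_C P)"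
    using P A B C km \<open>a = b\<close> by (intro exI[of _ ?P]) simp
qed

end
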